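(* Up to isomorphism, there are precisely two maximal strongly $(3,4)$-clique-partitioned graphs.
   Context: A $v$-clique is a set of $v$ pairwise adjacent vertices. A graph of order $nv$ is weakly $(n,v)$-clique-partitioned if its vertex set can be decomposed in a unique way into $n$ vertex-disjoint $v$-cliques; it is strongly $(n,v)$-clique-partitioned if moreover the only $v$-cliques in it are the $n$ cliques of that decomposition. Every strongly $(n,v)$-clique-partitioned graph has at most $\frac{n}{2}v(v-1)+\frac{nv(n-1)(v-2)}{2}$ edges; one is called maximal if it has exactly this many edges (for $(n,v)=(3,4)$ this is $42$ edges). *)

theory Defs
  imports Complex_Main "HOL-Library.Disjoint_Sets" "HOL-Library.Ramsey"
begin

text \<open>Finite simple graphs, given by a vertex set and a set of two-element edges
  (\<open>nsets V 2\<close> is the set of two-element subsets of \<open>V\<close>).\<close>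

definition simple_graph :: "'a set \<Rightarrow> 'a set set \<Rightarrow> bool" where
  "simple_graph V E \<longleftrightarrow> finite V \<and> E \<subseteq> nsets V 2"

definition graph_iso :: "'a set \<Rightarrow> 'a set set \<Rightarrow> 'b set \<Rightarrow> 'b set set \<Rightarrow> bool" where
  "graph_iso V E W F \<longleftrightarrow>
     (\<exists>f. bij_betw f V W \<and> (\<forall>x\<in>V. \<forall>y\<in>V. {x, y} \<in> E \<longleftrightarrow> {f x, f y} \<in> F))"

definition cliques :: "nat \<Rightarrow> 'a set \<Rightarrow> 'a set set \<Rightarrow> 'a set set" where
  "cliques v V E = {K \<in> nsets V v. \<forall>x\<in>K. \<forall>y\<in>K. x \<noteq> y \<longrightarrow> {x, y} \<in> E}"

definition clique_decomposition ::
  "nat \<Rightarrow> nat \<Rightarrow> 'a set \<Rightarrow> 'a set set \<Rightarrow> 'a set set \<Rightarrow> bool" where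
  "clique_decomposition n v V E P \<longleftrightarrow>
     partition_on V P \<and> card P = n \<and> P \<subseteq> cliques v V E"

definition weakly_clique_partitioned :: "nat \<Rightarrow> nat \<Rightarrow> 'a set \<Rightarrow> 'a set set \<Rightarrow> bool" where
  "weakly_clique_partitioned n v V E \<longleftrightarrow>
     simple_graph V E \<and> card V = n * v \<and> (\<exists>!P. clique_decomposition n v V E P)"

definition strongly_clique_partitioned :: "nat \<Rightarrow> nat \<Rightarrow> 'a set \<Rightarrow> 'a set set \<Rightarrow> bool" where
  "strongly_clique_partitioned n v V E \<longleftrightarrow>
     weakly_clique_partitioned n v V E \<and>
     (\<forall>P. clique_decomposition n v V E P \<longrightarrow> cliques v V E = P)"

text \<open>The edge count is stated over the reals, so that neither the subtractions nor
  the halves are truncated.\<close>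

definition maximal_strongly_clique_partitioned ::
  "nat \<Rightarrow> nat \<Rightarrow> 'a set \<Rightarrow> 'a set set \<Rightarrow> bool" where
  "maximal_strongly_clique_partitioned n v V E \<longleftrightarrow>
     strongly_clique_partitioned n v V E \<and>
     real (card E) = real n / 2 * real v * (real v - 1)
       + real n * real v * (real n - 1) * (real v - 2) / 2"

end

theory Submission
  imports Defs "HOL-Library.Sublist"
begin

text \<open>A vertex outside one of the three cliques has at most two neighbours in it, so 42 edges force
  exactly two, and any two cliques are joined by an 8-cycle. Labelling the first two cliques
  accordingly leaves only the neighbourhoods of the four vertices of the third clique to be chosen;
  a search finds 14 possibilities, each isomorphic to one of two graphs, which are told apart by
  their numbers of triangles, 40 and 42.\<close>

subsection \<open>Enumerating cliques\<close>

text \<open>The strong condition is always used in one form: since the 4-cliques are disjoint, no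
  four pairwise adjacent vertices can meet one of the three cliques without being that clique. Three
  neighbours of an outside vertex in a clique would give such a set, and so would two vertices of
  one clique with the same two neighbours in another. The bipartite graph between two cliques is
  2-regular on 4 + 4 vertices, hence an 8-cycle or two 4-cycles, and the second exclusion rules out
  the 4-cycles. An 8-cycle can be labelled in one standard way, so the first two cliques leave no
  choice. What shapes the rest is the size of the search: four neighbourhoods of four vertices each
  among eight allow 70^4 ordered choices. The four neighbourhoods are distinct, so the third clique
  can be listed in the order of its neighbourhoods, which removes the 4! orderings, and the
  conditions on pairs prune after every choice. \<open>pairwise_subseqs\<close> does this by
  filtering the remaining candidates; with adjacency as the relation, the same function lists the
  edges, triangles and 4-cliques of a concrete graph.\<close>

fun pairwise_subseqs :: "('a \<Rightarrow> 'a \<Rightarrow> bool) \<Rightarrow> nat \<Rightarrow> 'a list \<Rightarrow> 'a list list" where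
  "pairwise_subseqs R 0 xs = [[]]"
| "pairwise_subseqs R (Suc k) [] = []"
| "pairwise_subseqs R (Suc k) (x # xs) =
     map ((#) x) (pairwise_subseqs R k (filter (R x) xs)) @ pairwise_subseqs R (Suc k) xs"

lemma set_mono_subseq: "subseq xs ys \<Longrightarrow> set xs \<subseteq> set ys"
  by (induction rule: list_emb.induct) auto

lemma subseq_filter_iff: "subseq ys (filter P xs) \<longleftrightarrow> subseq ys xs \<and> (\<forall>y\<in>set ys. P y)"
proof
  assume "subseq ys (filter P xs)"
  then show "subseq ys xs \<and> (\<forall>y\<in>set ys. P y)"
    using subseq_order.trans[OF _ subseq_filter_left] set_mono_subseq[of ys "filter P xs"] by auto
next
  assume "subseq ys xs \<and> (\<forall>y\<in>set ys. P y)"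
  then show "subseq ys (filter P xs)"
    by (metis filter_True subseq_filter)
qed

lemma set_pairwise_subseqs:
  "set (pairwise_subseqs R k xs) = {ys. subseq ys xs \<and> length ys = k \<and> sorted_wrt R ys}"
proof (induction R k xs rule: pairwise_subseqs.induct)
  case (3 R k x xs)
  have "subseq ys (x # xs) \<and> length ys = Suc k \<and> sorted_wrt R ys \<longleftrightarrow>
      ys \<in> set (pairwise_subseqs R (Suc k) (x # xs))" for ys
  proof (cases ys)
    case (Cons z zs)
    then show ?thesis
      using 3 by (auto simp: subseq_filter_iff dest: subseq_Cons')
  qed (simp add: 3 image_iff)
  then show ?case by blast
qed auto

lemma distinct_pairwise_subseqs:
  assumes "distinct xs"
  shows "distinct (pairwise_subseqs R k xs)"
  using assms
proof (induction R k xs rule: pairwise_subseqs.induct)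
  case (3 R k x xs)
  have "x # ys \<notin> set (pairwise_subseqs R (Suc k) xs)" for ys
  proof
    assume "x # ys \<in> set (pairwise_subseqs R (Suc k) xs)"
    then have "subseq (x # ys) xs" by (simp add: set_pairwise_subseqs)
    from set_mono_subseq[OF this] have "x \<in> set xs" by simp
    with 3 show False by simp
  qed
  with 3 show ?case by (auto simp: distinct_map)
qed auto

text \<open>In a distinct list a subsequence is determined by its set of entries. Hence distinct
  lists in the enumeration give distinct cliques, and lengths can be read as cardinalities.\<close>

lemma subseq_eq_filter:
  "subseq ys xs \<Longrightarrow> distinct xs \<Longrightarrow> filter (\<lambda>x. x \<in> set ys) xs = ys"
proof (induction rule: list_emb.induct)
  case (list_emb_Cons xs ys y)
  then show ?case using set_mono_subseq[of xs ys] by auto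
next
  case (list_emb_Cons2 x y xs ys)
  have "filter (\<lambda>z. z \<in> set (x # xs)) ys = filter (\<lambda>z. z \<in> set xs) ys"
    using list_emb_Cons2.prems list_emb_Cons2.hyps by (intro filter_cong) auto
  also have "\<dots> = xs"
    using list_emb_Cons2.IH list_emb_Cons2.prems by simp
  finally show ?case using list_emb_Cons2.hyps by simp
qed simp

lemma distinct_if_subseq:
  assumes "subseq ys xs" "distinct xs"
  shows "distinct ys"
  using distinct_filter[OF assms(2), of "\<lambda>x. x \<in> set ys"] subseq_eq_filter[OF assms] by simp

lemma sorted_wrt_if_pairwise:
  assumes "distinct xs" "\<And>x y. x \<in> set xs \<Longrightarrow> y \<in> set xs \<Longrightarrow> x \<noteq> y \<Longrightarrow> R x y"
  shows "sorted_wrt R xs"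
  using assms by (induction xs) auto

lemma pairwise_if_sorted_wrt:
  assumes "sorted_wrt R xs" "symp R" "x \<in> set xs" "y \<in> set xs" "x \<noteq> y"
  shows "R x y"
  using assms by (induction xs) (auto dest: sympD)

text \<open>Filtering \<open>xs\<close> by membership in a clique picks its one representative among
  the subsequences. \<open>sorted_wrt\<close> tests each pair in list order only; symmetry of
  \<open>R\<close> supplies the other order.\<close>

lemma cliques_set_eq:
  assumes "distinct xs" "symp R"
    and R: "\<And>x y. x \<in> set xs \<Longrightarrow> y \<in> set xs \<Longrightarrow> x \<noteq> y \<Longrightarrow> {x, y} \<in> E \<longleftrightarrow> R x y"
  shows "cliques k (set xs) E = set ` set (pairwise_subseqs R k xs)"
proof (intro equalityI subsetI)
  fix K assume K: "K \<in> cliques k (set xs) E"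
  then have sub: "K \<subseteq> set xs" and "finite K" "card K = k"
    and adj: "\<And>x y. x \<in> K \<Longrightarrow> y \<in> K \<Longrightarrow> x \<noteq> y \<Longrightarrow> {x, y} \<in> E"
    by (auto simp: cliques_def nsets_def)
  define ys where "ys = filter (\<lambda>x. x \<in> K) xs"
  have "set ys = K" using sub by (auto simp: ys_def)
  moreover have "distinct ys" using assms(1) by (simp add: ys_def)
  moreover have "length ys = k"
    using calculation \<open>card K = k\<close> distinct_card by force
  moreover have "sorted_wrt R ys"
  proof (rule sorted_wrt_if_pairwise[OF \<open>distinct ys\<close>])
    fix x y assume "x \<in> set ys" "y \<in> set ys" "x \<noteq> y"
    with adj[of x y] R[of x y] sub \<open>set ys = K\<close> show "R x y" by blast
  qed
  ultimately show "K \<in> set ` set (pairwise_subseqs R k xs)"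
    by (intro image_eqI[of _ _ ys]) (auto simp: set_pairwise_subseqs ys_def)
next
  fix K assume "K \<in> set ` set (pairwise_subseqs R k xs)"
  then obtain ys where ys: "K = set ys" "subseq ys xs" "length ys = k" "sorted_wrt R ys"
    by (auto simp: set_pairwise_subseqs)
  have "set ys \<subseteq> set xs" "distinct ys"
    using set_mono_subseq[OF ys(2)] distinct_if_subseq[OF ys(2) assms(1)] .
  then show "K \<in> cliques k (set xs) E"
    using ys(1,3) pairwise_if_sorted_wrt[OF ys(4) assms(2)] R
    by (auto simp: cliques_def nsets_def distinct_card subset_iff)
qed

lemma card_cliques_set:
  assumes "distinct xs" "symp R"
    and "\<And>x y. x \<in> set xs \<Longrightarrow> y \<in> set xs \<Longrightarrow> x \<noteq> y \<Longrightarrow> {x, y} \<in> E \<longleftrightarrow> R x y"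
  shows "card (cliques k (set xs) E) = length (pairwise_subseqs R k xs)"
proof -
  have "inj_on set (set (pairwise_subseqs R k xs))"
  proof (rule inj_onI)
    fix ys zs assume "ys \<in> set (pairwise_subseqs R k xs)" "zs \<in> set (pairwise_subseqs R k xs)"
      and eq: "set ys = set zs"
    then have "subseq ys xs" "subseq zs xs" by (simp_all add: set_pairwise_subseqs)
    from this[THEN subseq_eq_filter[OF _ assms(1)]] show "ys = zs"
      unfolding eq by (rule trans[OF sym])
  qed
  then show ?thesis
    using cliques_set_eq[OF assms] distinct_pairwise_subseqs[OF assms(1)]
    by (simp add: card_image distinct_card)
qed

text \<open>Lets the edge count be computed by the enumeration that also lists the
  4-cliques.\<close>

lemma cliques_2_eq_edges:
  assumes "simple_graph V E"
  shows "cliques 2 V E = E"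
proof -
  have "(\<forall>x\<in>K. \<forall>y\<in>K. x \<noteq> y \<longrightarrow> {x, y} \<in> E) \<longleftrightarrow> K \<in> E" if K: "K \<in> nsets V 2" for K
  proof -
    obtain a b where "K = {a, b}" "a \<noteq> b"
      using K by (auto simp: nsets_def card_2_iff)
    then show ?thesis by (auto simp: insert_commute)
  qed
  then show ?thesis
    using assms by (auto simp: simple_graph_def cliques_def)
qed

subsection \<open>Isomorphism\<close>

lemma graph_iso_sym:
  assumes "graph_iso V E W F"
  shows "graph_iso W F V E"
proof -
  obtain f where f: "bij_betw f V W" "\<And>x y. x \<in> V \<Longrightarrow> y \<in> V \<Longrightarrow> {x, y} \<in> E \<longleftrightarrow> {f x, f y} \<in> F"
    using assms by (auto simp: graph_iso_def)
  let ?g = "inv_into V f"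
  have "?g y \<in> V" "f (?g y) = y" if "y \<in> W" for y
    using f(1) that by (auto simp: bij_betw_def inv_into_into f_inv_into_f)
  then have "\<forall>x\<in>W. \<forall>y\<in>W. {x, y} \<in> F \<longleftrightarrow> {?g x, ?g y} \<in> E"
    using f(2) by simp
  then show ?thesis
    using bij_betw_inv_into[OF f(1)] unfolding graph_iso_def by blast
qed

lemma graph_iso_trans:
  assumes "graph_iso V E W F" "graph_iso W F X G"
  shows "graph_iso V E X G"
proof -
  obtain f where f: "bij_betw f V W" "\<And>x y. x \<in> V \<Longrightarrow> y \<in> V \<Longrightarrow> {x, y} \<in> E \<longleftrightarrow> {f x, f y} \<in> F"
    using assms by (auto simp: graph_iso_def)
  obtain g where g: "bij_betw g W X" "\<And>x y. x \<in> W \<Longrightarrow> y \<in> W \<Longrightarrow> {x, y} \<in> F \<longleftrightarrow> {g x, g y} \<in> G"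
    using assms by (auto simp: graph_iso_def)
  have "f x \<in> W" if "x \<in> V" for x using f(1) that by (auto simp: bij_betw_def)
  then show ?thesis
    using bij_betw_trans[OF f(1) g(1)] f(2) g(2)
    unfolding graph_iso_def by (intro exI[of _ "g \<circ> f"]) simp
qed

lemma graph_iso_card_cliques:
  assumes "graph_iso V E W F"
  shows "card (cliques k V E) = card (cliques k W F)"
proof -
  obtain f where f: "bij_betw f V W" "\<And>x y. x \<in> V \<Longrightarrow> y \<in> V \<Longrightarrow> {x, y} \<in> E \<longleftrightarrow> {f x, f y} \<in> F"
    using assms by (auto simp: graph_iso_def)
  have inj: "inj_on f K" if "K \<subseteq> V" for K
    using f(1) that inj_on_subset by (auto simp: bij_betw_def)
  have "bij_betw ((`) f) (nsets V k) (nsets W k)"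
    using f(1) by (rule bij_betw_nsets)
  then have "bij_betw ((`) f) (cliques k V E) (cliques k W F)"
  proof (rule bij_betw_subset)
    show "cliques k V E \<subseteq> nsets V k" by (auto simp: cliques_def)
    have pair: "(\<forall>x\<in>f ` K. \<forall>y\<in>f ` K. x \<noteq> y \<longrightarrow> {x, y} \<in> F) \<longleftrightarrow>
        (\<forall>x\<in>K. \<forall>y\<in>K. x \<noteq> y \<longrightarrow> {x, y} \<in> E)" if "K \<in> nsets V k" for K
    proof -
      have "K \<subseteq> V" using that by (auto simp: nsets_def)
      with f(2) inj[OF this] show ?thesis
        by (auto simp: inj_on_eq_iff subset_iff)
    qed
    have "nsets W k = (`) f ` nsets V k"
      using bij_betw_nsets[OF f(1)] by (simp add: bij_betw_def)
    with pair show "(`) f ` cliques k V E = cliques k W F"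
      unfolding cliques_def by (auto simp: image_iff)
  qed
  then show ?thesis by (rule bij_betw_same_card)
qed

subsection \<open>Graphs given by lists of earlier neighbours\<close>

text \<open>An edge is meant to be stored once, in the list of its later endpoint, so both lists are
  consulted. With this storage, new vertices are added by appending lists, without changing the old
  ones.\<close>

definition adjacent :: "nat list list \<Rightarrow> nat \<Rightarrow> nat \<Rightarrow> bool" where
  "adjacent L x y \<longleftrightarrow> x \<in> set (L ! y) \<or> y \<in> set (L ! x)"

definition edges :: "nat list list \<Rightarrow> nat set set" where
  "edges L = {{x, y} | x y. y < length L \<and> x \<in> set (L ! y)}"

lemma symp_adjacent: "symp (adjacent L)"
  by (auto simp: symp_def adjacent_def)

lemma mem_edges_iff:
  "x < length L \<Longrightarrow> y < length L \<Longrightarrow> {x, y} \<in> edges L \<longleftrightarrow> adjacent L x y"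
  by (auto simp: edges_def adjacent_def doubleton_eq_iff)

definition earlier_neighbours :: "'a set set \<Rightarrow> 'a list \<Rightarrow> nat list list \<Rightarrow> bool" where
  "earlier_neighbours E vs L \<longleftrightarrow>
     (\<forall>j<length L. set (L ! j) = {i. i < j \<and> {vs ! i, vs ! j} \<in> E})"

lemma earlier_neighbours_edge_iff:
  assumes "earlier_neighbours E vs L" "i < length L" "j < length L" "i \<noteq> j"
  shows "{vs ! i, vs ! j} \<in> E \<longleftrightarrow> adjacent L i j"
  using assms by (cases i j rule: linorder_cases)
    (auto simp: earlier_neighbours_def adjacent_def insert_commute)

text \<open>The isomorphism is the inverse of indexing into \<open>vs\<close>. Besides labellings of
  an arbitrary graph, \<open>vs\<close> can be a permutation of the vertices of a concrete graph, so
  the same lemma also verifies explicit isomorphisms.\<close>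

lemma graph_iso_if_earlier_neighbours:
  assumes "simple_graph V E" "distinct vs" "set vs = V" "length L = length vs"
    "earlier_neighbours E vs L"
  shows "graph_iso V E {..<length L} (edges L)"
proof (rule graph_iso_sym)
  have "bij_betw ((!) vs) {..<length L} V"
    using assms by (intro bij_betw_nth) auto
  moreover have "{x, y} \<in> edges L \<longleftrightarrow> {vs ! x, vs ! y} \<in> E" if "x < length L" "y < length L" for x y
  proof (cases "x = y")
    \<comment> \<open>\<open>graph_iso\<close> compares the case \<open>x = y\<close> as well: a
      singleton is not an edge, and no index occurs in its own list of earlier neighbours.\<close>
    case True
    have "{vs ! x, vs ! y} \<notin> E"
      using assms(1) True by (auto simp: simple_graph_def nsets_def)
    moreover have "\<not> adjacent L x y"
      using assms(5) True that by (auto simp: adjacent_def earlier_neighbours_def)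
    ultimately show ?thesis using that by (simp add: mem_edges_iff)
  next
    case False
    with that assms(5) show ?thesis
      by (simp add: mem_edges_iff earlier_neighbours_edge_iff)
  qed
  ultimately show "graph_iso {..<length L} (edges L) V E"
    unfolding graph_iso_def by blast
qed

lemma simple_graph_edges:
  assumes "\<And>j. j < length L \<Longrightarrow> set (L ! j) \<subseteq> {..<j}"
  shows "simple_graph {..<length L} (edges L)"
  using assms by (fastforce simp: simple_graph_def edges_def nsets_def card_2_iff)

lemma card_cliques_edges:
  "card (cliques k {..<length L} (edges L)) = length (pairwise_subseqs (adjacent L) k [0..<length L])"
  using card_cliques_set[of "[0..<length L]" "adjacent L" "edges L" k] symp_adjacent
  by (simp add: mem_edges_iff lessThan_atLeast0)

lemma cliques_edges:
  "cliques k {..<length L} (edges L) = set ` set (pairwise_subseqs (adjacent L) k [0..<length L])"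
  using cliques_set_eq[of "[0..<length L]" "adjacent L" "edges L" k] symp_adjacent
  by (simp add: mem_edges_iff lessThan_atLeast0)

subsection \<open>Maximal strongly clique-partitioned graphs\<close>

text \<open>When there are exactly \<open>n\<close> cliques, a decomposition into \<open>n\<close>
  of them must use them all; this gives uniqueness and the strong condition at once.\<close>

lemma strongly_clique_partitionedI:
  assumes "simple_graph V E" "card V = n * v" "partition_on V (cliques v V E)"
    "card (cliques v V E) = n" "n > 0"
  shows "strongly_clique_partitioned n v V E"
proof -
  \<comment> \<open>An infinite set would have \<open>card\<close> 0, which \<open>n > 0\<close>
    excludes.\<close>
  have "finite (cliques v V E)" using assms(4,5) card_ge_0_finite by blast
  then have "P \<subseteq> cliques v V E \<Longrightarrow> card P = n \<Longrightarrow> P = cliques v V E" for P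
    using card_subset_eq[of "cliques v V E" P] assms(4) by simp
  then have "clique_decomposition n v V E P \<longleftrightarrow> P = cliques v V E" for P
    using assms(3,4) by (auto simp: clique_decomposition_def)
  then show ?thesis
    using assms(1,2) by (simp add: strongly_clique_partitioned_def weakly_clique_partitioned_def)
qed

text \<open>The handshake lemma, by counting incident pairs of a vertex and an edge in two
  ways.\<close>

lemma sum_neighbours_eq:
  assumes "simple_graph V E"
  shows "(\<Sum>x\<in>V. card {y \<in> V. {x, y} \<in> E}) = 2 * card E"
proof -
  have fin: "finite V" "finite E" and E: "E \<subseteq> nsets V 2"
    using assms finite_imp_finite_nsets finite_subset by (auto simp: simple_graph_def)
  have "card {y \<in> V. {x, y} \<in> E} = card {e \<in> E. x \<in> e}" if "x \<in> V" for x
  proof (rule bij_betw_same_card[of "\<lambda>y. {x, y}"], rule bij_betwI')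
    fix e assume e: "e \<in> {e \<in> E. x \<in> e}"
    then have "e \<in> nsets V 2" using E by blast
    then obtain a b where "e = {a, b}" "a \<in> V" "b \<in> V" by (auto simp: nsets_def card_2_iff)
    with e show "\<exists>y\<in>{y \<in> V. {x, y} \<in> E}. e = {x, y}"
      by (auto simp: insert_commute)
  qed (auto simp: doubleton_eq_iff)
  then have "(\<Sum>x\<in>V. card {y \<in> V. {x, y} \<in> E}) = (\<Sum>x\<in>V. card {e \<in> E. x \<in> e})"
    by simp
  also have "\<dots> = 2 * card E"
  proof (rule sum_multicount[OF fin])
    have "{x \<in> V. x \<in> e} = e" "card e = 2" if "e \<in> E" for e
      using E that by (auto simp: nsets_def)
    then show "\<forall>e\<in>E. card {x \<in> V. x \<in> e} = 2" by simp
  qed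
  finally show ?thesis .
qed

text \<open>With \<open>v - 1\<close> neighbours in \<open>K\<close>, the vertex \<open>x\<close>
  would complete a \<open>v\<close>-clique that meets \<open>K\<close> but differs from it,
  contradicting disjointness.\<close>

lemma card_neighbours_in_clique_le:
  assumes "partition_on V (cliques v V E)" "simple_graph V E" "v \<ge> 2"
    and K: "K \<in> cliques v V E" and x: "x \<in> V - K"
  shows "card {y \<in> K. {x, y} \<in> E} \<le> v - 2"
proof (rule ccontr)
  assume "\<not> ?thesis"
  then have "v - 1 \<le> card {y \<in> K. {x, y} \<in> E}" by simp
  then obtain S where S: "S \<subseteq> {y \<in> K. {x, y} \<in> E}" "card S = v - 1"
    by (rule obtain_subset_with_card_n)
  have "finite S"
    using S(2) assms(3) card.infinite by fastforce
  have KV: "K \<subseteq> V" and Kadj: "\<And>y z. y \<in> K \<Longrightarrow> z \<in> K \<Longrightarrow> y \<noteq> z \<Longrightarrow> {y, z} \<in> E"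
    using K by (auto simp: cliques_def nsets_def)
  have "x \<notin> S" using S(1) x by auto
  then have "card (insert x S) = v"
    using S(2) \<open>finite S\<close> assms(3) by simp
  moreover have "{y, z} \<in> E" if "y \<in> insert x S" "z \<in> insert x S" "y \<noteq> z" for y z
    using that S(1) Kadj by (auto simp: insert_commute)
  ultimately have "insert x S \<in> cliques v V E"
    using S(1) KV x \<open>finite S\<close> by (auto simp: cliques_def nsets_def)
  moreover have "insert x S \<noteq> K" using x by auto
  ultimately have "insert x S \<inter> K = {}"
    using disjointD[OF partition_onD2[OF assms(1)]] K by blast
  moreover have "S \<noteq> {}" using S(2) assms(3) by auto
  ultimately show False using S(1) by blast
qed

lemma maximal_strongly_clique_partitionedD:
  assumes "maximal_strongly_clique_partitioned n v V E"
  shows "simple_graph V E" "card V = n * v" "partition_on V (cliques v V E)"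
    "card (cliques v V E) = n"
proof -
  show "simple_graph V E" "card V = n * v"
    using assms by (simp_all add: maximal_strongly_clique_partitioned_def
      strongly_clique_partitioned_def weakly_clique_partitioned_def)
  obtain P where "clique_decomposition n v V E P" "cliques v V E = P"
    using assms by (auto simp: maximal_strongly_clique_partitioned_def
      strongly_clique_partitioned_def weakly_clique_partitioned_def)
  then show "partition_on V (cliques v V E)" "card (cliques v V E) = n"
    by (simp_all add: clique_decomposition_def)
qed

text \<open>Each vertex has at most \<open>(v - 1) + (n - 1) * (v - 2)\<close> neighbours, and the edge count of
  a maximal graph is the one of a graph in which all vertices attain this bound.\<close>

lemma card_neighbours_in_clique:
  assumes max: "maximal_strongly_clique_partitioned n v V E" and v: "v \<ge> 2"
    and K: "K \<in> cliques v V E" and x: "x \<in> V - K"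
  shows "card {y \<in> K. {x, y} \<in> E} = v - 2"
proof -
  let ?P = "cliques v V E"
  note sg = maximal_strongly_clique_partitionedD(1)[OF max]
    and V = maximal_strongly_clique_partitionedD(2)[OF max]
    and part = maximal_strongly_clique_partitionedD(3)[OF max]
    and n = maximal_strongly_clique_partitionedD(4)[OF max]
  have fin: "finite V" "finite ?P"
    using sg finite_imp_finite_nsets[of V v] finite_subset[of ?P "nsets V v"]
    by (auto simp: simple_graph_def cliques_def)
  have finK: "finite L" if "L \<in> ?P" for L
    using that by (auto simp: cliques_def nsets_def)
  define d where "d = (\<lambda>x L. card {y \<in> L. {x, y} \<in> E})"
  have deg: "card {y \<in> V. {x, y} \<in> E} = (\<Sum>L\<in>?P. d x L)" for x
  proof -
    have "{y \<in> V. {x, y} \<in> E} = (\<Union>L\<in>?P. {y \<in> L. {x, y} \<in> E})"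
      using part by (auto simp: partition_on_def)
    also have "card \<dots> = (\<Sum>L\<in>?P. d x L)"
      unfolding d_def
    proof (rule card_UN_disjoint)
      show "\<forall>L\<in>?P. \<forall>L'\<in>?P. L \<noteq> L' \<longrightarrow> {y \<in> L. {x, y} \<in> E} \<inter> {y \<in> L'. {x, y} \<in> E} = {}"
        using part unfolding partition_on_def disjoint_def by blast
    qed (use fin finK in auto)
    finally show ?thesis .
  qed
  have own: "\<exists>L\<in>?P. x \<in> L \<and> d x L = v - 1" if x: "x \<in> V" for x
  proof -
    obtain L where L: "L \<in> ?P" "x \<in> L"
      using x part by (auto simp: partition_on_def)
    have "{x, x} \<notin> E" using sg by (auto simp: simple_graph_def nsets_def)
    then have "{y \<in> L. {x, y} \<in> E} = L - {x}" "card L = v"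
      using L by (auto simp: cliques_def nsets_def)
    then have "d x L = v - 1" using L(2) by (simp add: d_def)
    with L show ?thesis by blast
  qed
  have rest: "(\<Sum>L\<in>?P. d x L) = (v - 1) + (\<Sum>L\<in>?P - {L0}. d x L)"
    if "L0 \<in> ?P" "d x L0 = v - 1" for x L0
    using that fin by (simp add: sum.remove)
  have le: "d y L \<le> v - 2" if "L \<in> ?P" "L' \<in> ?P" "y \<in> L'" "L \<noteq> L'" for y L L'
  proof -
    have "y \<in> V - L"
      using that part by (auto simp: partition_on_def disjoint_def)
    then show ?thesis
      unfolding d_def using card_neighbours_in_clique_le[OF part sg v that(1)] by blast
  qed
  have sum_le: "(\<Sum>L\<in>?P. d y L) \<le> (v - 1) + (n - 1) * (v - 2)" if y: "y \<in> V" for y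
  proof -
    obtain L0 where L0: "L0 \<in> ?P" "y \<in> L0" "d y L0 = v - 1" using own[OF y] by blast
    have "(\<Sum>L\<in>?P - {L0}. d y L) \<le> (\<Sum>L\<in>?P - {L0}. v - 2)"
      using L0 le by (intro sum_mono) blast
    also have "\<dots> = (n - 1) * (v - 2)" using L0(1) n fin by simp
    finally show ?thesis using rest[OF L0(1,3)] by simp
  qed
  have "n \<ge> 1" using K n fin(2) by (metis One_nat_def Suc_leI card_gt_0_iff empty_iff)
  \<comment> \<open>The real-valued edge count moves to the naturals; \<open>v \<ge> 2\<close> and
    \<open>n \<ge> 1\<close> ensure that no subtraction truncates.\<close>
  have "2 * card E = n * v * ((v - 1) + (n - 1) * (v - 2))"
  proof -
    have "2 * real (card E) = real n * real v * ((real v - 1) + (real n - 1) * (real v - 2))"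
      using max by (simp add: maximal_strongly_clique_partitioned_def field_simps)
    also have "\<dots> = real (n * v * ((v - 1) + (n - 1) * (v - 2)))"
      using v \<open>n \<ge> 1\<close> by (simp add: of_nat_diff)
    finally show ?thesis by linarith
  qed
  \<comment> \<open>By \<open>sum_le\<close> every inner sum is at most the constant on the right,
    so equal totals force equality at \<open>x\<close>. The same argument, applied to the sum over
    the cliques not containing \<open>x\<close>, then forces equality at \<open>K\<close>.\<close>
  then have total: "(\<Sum>y\<in>V. \<Sum>L\<in>?P. d y L) = (\<Sum>y\<in>V. (v - 1) + (n - 1) * (v - 2))"
    using sum_neighbours_eq[OF sg] deg V by simp
  have x': "x \<in> V" using x by simp
  obtain L0 where L0: "L0 \<in> ?P" "x \<in> L0" "d x L0 = v - 1" using own[OF x'] by blast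
  have "(\<Sum>L\<in>?P. d x L) = (v - 1) + (n - 1) * (v - 2)"
    using sum_mono_inv[OF total sum_le x' fin(1)] .
  then have "(\<Sum>L\<in>?P - {L0}. d x L) = (\<Sum>L\<in>?P - {L0}. v - 2)"
    using rest[OF L0(1,3)] L0(1) n fin by simp
  then have "d x K = v - 2"
  proof (rule sum_mono_inv)
    show "K \<in> ?P - {L0}" using K L0 x by auto
    show "d x L \<le> v - 2" if "L \<in> ?P - {L0}" for L using that L0 le by blast
  qed (use fin in auto)
  then show ?thesis by (simp add: d_def)
qed

text \<open>Two vertices of \<open>L\<close> with the same \<open>v - 2\<close> neighbours in
  \<open>K\<close> would form a \<open>v\<close>-clique with them; it meets \<open>K\<close> because
  \<open>v \<ge> 3\<close>, yet is not \<open>K\<close>. For \<open>v = 4\<close> this excludes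
  4-cycles between two cliques, and it makes the vertices of the third clique distinguishable by
  their neighbourhoods.\<close>

lemma inj_on_neighbours_in_clique:
  assumes max: "maximal_strongly_clique_partitioned n v V E" and v: "v \<ge> 3"
    and K: "K \<in> cliques v V E" and L: "L \<in> cliques v V E" and "K \<noteq> L"
  shows "inj_on (\<lambda>y. {x \<in> K. {x, y} \<in> E}) L"
proof (rule inj_onI, rule ccontr)
  fix y z assume yz: "y \<in> L" "z \<in> L" "y \<noteq> z"
    and eq: "{x \<in> K. {x, y} \<in> E} = {x \<in> K. {x, z} \<in> E}"
  define T where "T = {x \<in> K. {x, y} \<in> E}"
  note disj = disjointD[OF partition_onD2[OF maximal_strongly_clique_partitionedD(3)[OF max]]]
  have KL: "K \<inter> L = {}" using disj[OF K L] \<open>K \<noteq> L\<close> .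
  have KV: "K \<subseteq> V" "finite K" and Kadj: "\<And>x y. x \<in> K \<Longrightarrow> y \<in> K \<Longrightarrow> x \<noteq> y \<Longrightarrow> {x, y} \<in> E"
    using K by (auto simp: cliques_def nsets_def)
  have LV: "L \<subseteq> V" and Ladj: "\<And>x y. x \<in> L \<Longrightarrow> y \<in> L \<Longrightarrow> x \<noteq> y \<Longrightarrow> {x, y} \<in> E"
    using L by (auto simp: cliques_def nsets_def)
  have T: "T \<subseteq> K" "finite T" using KV(2) by (auto simp: T_def)
  have "card T = v - 2"
    using card_neighbours_in_clique[OF max _ K, of y] v yz(1) KL LV
    by (auto simp: T_def insert_commute)
  moreover have "y \<notin> insert z T" "z \<notin> T" using T(1) yz KL by auto
  ultimately have card: "card (insert y (insert z T)) = v" and "T \<noteq> {}"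
    using T(2) v by auto
  have Ty: "{x, y} \<in> E" and Tz: "{x, z} \<in> E" if "x \<in> T" for x
    using that eq by (auto simp: T_def)
  have "{s, t} \<in> E" if "s \<in> insert y (insert z T)" "t \<in> insert y (insert z T)" "s \<noteq> t" for s t
    using that Ty Tz Kadj Ladj[OF yz] subsetD[OF T(1)] by (auto simp: insert_commute)
  then have "insert y (insert z T) \<in> cliques v V E"
    using card T KV(1) LV yz by (auto simp: cliques_def nsets_def)
  moreover have "insert y (insert z T) \<noteq> K" using yz(1) KL by auto
  ultimately have "insert y (insert z T) \<inter> K = {}" using disj K by blast
  then show False using T(1) \<open>T \<noteq> {}\<close> by blast
qed

text \<open>A 2-regular bipartite graph on 4 + 4 vertices is an 8-cycle or two 4-cycles, and in a
  4-cycle two vertices of \<open>B\<close> would share their neighbourhood. The cycle is a0, b0, a1,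
  b1, a2, b2, a3, b3; the proof follows it from a0 in both directions.\<close>

lemma eight_cycle:
  fixes R :: "'a \<Rightarrow> 'b \<Rightarrow> bool"
  assumes A: "card A = 4" and B: "card B = 4"
    and RA: "\<And>a. a \<in> A \<Longrightarrow> card {b \<in> B. R a b} = 2"
    and RB: "\<And>b. b \<in> B \<Longrightarrow> card {a \<in> A. R a b} = 2"
    and inj: "inj_on (\<lambda>b. {a \<in> A. R a b}) B"
  obtains a0 a1 a2 a3 b0 b1 b2 b3 where
    "A = {a0, a1, a2, a3}" "B = {b0, b1, b2, b3}"
    "distinct [a0, a1, a2, a3]" "distinct [b0, b1, b2, b3]"
    "{a \<in> A. R a b0} = {a0, a1}" "{a \<in> A. R a b1} = {a1, a2}"
    "{a \<in> A. R a b2} = {a2, a3}" "{a \<in> A. R a b3} = {a0, a3}"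
proof -
  have nbA: "\<exists>b'. b' \<noteq> b \<and> {b \<in> B. R a b} = {b, b'}" if "a \<in> A" "b \<in> B" "R a b" for a b
    using RA[OF that(1)] that by (auto simp: card_2_iff doubleton_eq_iff set_eq_iff) metis+
  have nbB: "\<exists>a'. a' \<noteq> a \<and> {a \<in> A. R a b} = {a, a'}" if "a \<in> A" "b \<in> B" "R a b" for a b
    using RB[OF that(2)] that by (auto simp: card_2_iff doubleton_eq_iff set_eq_iff) metis+
  obtain a0 where a0: "a0 \<in> A" using A by fastforce
  obtain b0 b3 where b03: "b0 \<noteq> b3" "{b \<in> B. R a0 b} = {b0, b3}"
    using RA[OF a0] by (auto simp: card_2_iff)
  then have b: "b0 \<in> B" "b3 \<in> B" "R a0 b0" "R a0 b3" by auto
  obtain a1 where a1: "a1 \<noteq> a0" "{a \<in> A. R a b0} = {a0, a1}" using nbB[OF a0 b(1,3)] by blast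
  obtain a3 where a3: "a3 \<noteq> a0" "{a \<in> A. R a b3} = {a0, a3}" using nbB[OF a0 b(2,4)] by blast
  have a: "a1 \<in> A" "a3 \<in> A" "R a1 b0" "R a3 b3" using a1 a3 by auto
  \<comment> \<open>Otherwise b0 and b3 would have the same neighbourhood.\<close>
  have "a1 \<noteq> a3" using inj a1 a3 b b03 by (auto simp: inj_on_def)
  then have "card (A - {a0, a1, a3}) = 1"
    using A a a0 a1 a3 by (subst card_Diff_subset) auto
  then obtain a2 where "A - {a0, a1, a3} = {a2}" by (auto simp: card_1_singleton_iff)
  then have a2: "A = {a0, a1, a2, a3}" "a2 \<notin> {a0, a1, a3}" using a a0 by auto
  obtain b1 where b1: "b1 \<noteq> b0" "{b \<in> B. R a1 b} = {b0, b1}" using nbA[OF a(1) b(1) a(3)] by blast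
  then have b1': "b1 \<in> B" "R a1 b1" by auto
  have "b1 \<noteq> b3" using b1' a3 a1 a \<open>a1 \<noteq> a3\<close> by blast
  then have "card (B - {b0, b1, b3}) = 1"
    using B b b1 b1' b03 by (subst card_Diff_subset) auto
  then obtain b2 where "B - {b0, b1, b3} = {b2}" by (auto simp: card_1_singleton_iff)
  then have b2: "B = {b0, b1, b2, b3}" "b2 \<notin> {b0, b1, b3}" using b b1' by auto
  obtain x where x: "x \<noteq> a1" "{a \<in> A. R a b1} = {a1, x}" using nbB[OF a(1) b1'] by blast
  have "x \<in> A" "R x b1" using x by auto
  have "x \<noteq> a0" using \<open>R x b1\<close> b1' b1 b03 \<open>b1 \<noteq> b3\<close> by blast
  have a2': "\<not> R a2 b0" "\<not> R a2 b3" using a1 a3 a2 by blast+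
  \<comment> \<open>Otherwise b0, b1 and b3 would have all their neighbours among a0, a1 and a3,
    leaving only b2 for a2, which needs two.\<close>
  have "x \<noteq> a3"
  proof
    assume "x = a3"
    then have "\<not> R a2 b1" using x a2 by blast
    with a2' have "{b \<in> B. R a2 b} \<subseteq> {b2}" using b2 by auto
    then have "card {b \<in> B. R a2 b} \<le> card {b2}" by (intro card_mono) auto
    moreover have "a2 \<in> A" using a2 by auto
    ultimately show False using RA by fastforce
  qed
  with \<open>x \<in> A\<close> \<open>x \<noteq> a0\<close> x(1) have "x = a2" using a2 by auto
  have "\<not> R a0 b2" "\<not> R a1 b2" using b03 b1 b2 by blast+
  then have "{a \<in> A. R a b2} \<subseteq> {a2, a3}" using a2 by auto
  moreover have "card {a \<in> A. R a b2} = card {a2, a3}"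
    using RB b2 a2 by auto
  ultimately have "{a \<in> A. R a b2} = {a2, a3}" by (intro card_subset_eq) auto
  moreover have "distinct [a0, a1, a2, a3]" using a1(1) a3(1) a2(2) \<open>a1 \<noteq> a3\<close> by simp metis
  moreover have "distinct [b0, b1, b2, b3]" using b03(1) b1(1) b2(2) \<open>b1 \<noteq> b3\<close> by simp metis
  ultimately show ?thesis
    using that[OF a2(1) b2(1)] a1(2) a3(2) x(2) \<open>x = a2\<close> by simp
qed

subsection \<open>Three 4-cliques\<close>

text \<open>The vertices 0,1,2,3 and 4,5,6,7 form the first two cliques; the edges between them form
  the 8-cycle 0,4,1,5,2,6,3,7.\<close>

definition two_cliques :: "nat list list" where
  "two_cliques = [[], [0], [0,1], [0,1,2], [0,1], [1,2,4], [2,3,4,5], [0,3,4,5,6]]"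

definition third_clique :: "nat list list \<Rightarrow> nat list list" where
  "third_clique ts = two_cliques @ map2 (\<lambda>t j. t @ [8..<j]) ts [8..<12]"

text \<open>Together with a vertex of the third clique, a triangle in its neighbourhood would form a
  4-clique; together with two of them, so would an edge in their common neighbourhood.\<close>

definition neighbourhoods :: "nat list list" where
  "neighbourhoods = filter (\<lambda>t. pairwise_subseqs (adjacent two_cliques) 3 t = [])
     (pairwise_subseqs (\<lambda>_ _. True) 4 [0..<8])"

definition compatible :: "nat list \<Rightarrow> nat list \<Rightarrow> bool" where
  "compatible t u \<longleftrightarrow>
     pairwise_subseqs (adjacent two_cliques) 2 (filter (\<lambda>x. x \<in> set u) t) = []"

section \<open>Two representatives and explicit isomorphisms onto them\<close>

definition G1 :: "nat list list" where
  "G1 = third_clique [[0,1,5,6], [0,3,4,5], [1,2,6,7], [2,3,4,7]]"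

definition G2 :: "nat list list" where
  "G2 = third_clique [[0,1,5,6], [0,3,4,6], [1,2,4,7], [2,3,5,7]]"

text \<open>Entry \<open>i\<close> of a list is the vertex of \<open>G1\<close> or \<open>G2\<close>
  to which vertex \<open>i\<close> is sent. Most of the lists permute the three cliques, since
  different solutions of the search can arise from one graph by choosing other cliques as the first
  two. Twelve lists suffice for 14 solutions because a list may serve once for each target graph, as
  the identity does.\<close>

definition relabellings :: "nat list list" where
  "relabellings =
    [[0, 1, 2, 3, 4, 5, 6, 7, 8, 9, 10, 11], [0, 1, 2, 3, 8, 10, 11, 9, 4, 7, 5, 6],
     [1, 0, 3, 2, 4, 7, 6, 5, 8, 10, 9, 11], [1, 0, 3, 2, 8, 9, 11, 10, 4, 5, 7, 6],
     [4, 5, 6, 7, 1, 2, 3, 0, 9, 10, 8, 11], [4, 6, 5, 7, 9, 8, 11, 10, 1, 0, 2, 3],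
     [4, 7, 5, 6, 10, 11, 8, 9, 0, 1, 3, 2], [4, 7, 6, 5, 0, 3, 2, 1, 10, 9, 11, 8],
     [6, 4, 7, 5, 9, 10, 11, 8, 3, 2, 0, 1], [6, 5, 4, 7, 2, 1, 0, 3, 8, 9, 11, 10],
     [6, 5, 7, 4, 8, 11, 10, 9, 2, 3, 1, 0], [6, 7, 4, 5, 3, 0, 1, 2, 9, 8, 10, 11]]"

text \<open>The filter expresses the remaining degree condition: each of the first eight vertices
  has exactly two neighbours in the third clique. This also excludes 4-cliques made of three
  vertices of the third clique and one other.\<close>

lemma neighbourhoods_relabelling:
  "\<forall>ts\<in>set (filter (\<lambda>ts. \<forall>i\<in>set [0..<8]. length (filter (\<lambda>t. i \<in> set t) ts) = 2)
       (pairwise_subseqs compatible 4 neighbourhoods)).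
     \<exists>p\<in>set relabellings. \<exists>G\<in>set [G1, G2]. \<forall>j\<in>set [0..<12]. \<forall>i\<in>set [0..<j].
        i \<in> set (third_clique ts ! j) \<longleftrightarrow> adjacent G (p ! i) (p ! j)"
  by code_simp

lemma relabellings_permute:
  assumes "p \<in> set relabellings"
  shows "length p = 12" "distinct p" "set p = {..<12}"
proof -
  have "\<forall>p\<in>set relabellings. length p = 12 \<and> distinct p \<and> (\<forall>i\<in>set p. i < 12)" by code_simp
  then show p: "length p = 12" "distinct p" and "set p = {..<12}"
    using assms distinct_card[of p] card_subset_eq[of "{..<12}" "set p"] by auto
qed

section \<open>Maximality and non-isomorphism of the two representatives\<close>

lemma maximal_strongly_clique_partitioned_edges:
  assumes "length L = 12" "\<And>j. j < 12 \<Longrightarrow> set (L ! j) \<subseteq> {..<j}"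
    and "pairwise_subseqs (adjacent L) 4 [0..<12] = [[0,1,2,3], [4,5,6,7], [8,9,10,11]]"
    and "length (pairwise_subseqs (adjacent L) 2 [0..<12]) = 42"
  shows "maximal_strongly_clique_partitioned 3 4 {..<12} (edges L)"
proof -
  have sg: "simple_graph {..<12} (edges L)"
    using simple_graph_edges[of L] assms(1,2) by simp
  have cl: "cliques 4 {..<12} (edges L) = {{0,1,2,3}, {4,5,6,7}, {8,9,10,11}}"
    using cliques_edges[of 4 L] assms(1,3) by simp
  have "x \<in> \<Union> {{0,1,2,3}, {4,5,6,7}, {8,9,10,11}} \<longleftrightarrow> x \<in> {..<12}" for x :: nat
    by simp presburger
  then have "\<Union> {{0,1,2,3}, {4,5,6,7}, {8,9,10,11}} = {..<12::nat}"
    by (rule set_eqI)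
  then have "partition_on {..<12} (cliques 4 {..<12} (edges L))"
    unfolding cl partition_on_def disjoint_def by simp
  moreover have "card (cliques 4 {..<12} (edges L)) = 3"
    using card_cliques_edges[of 4 L] assms(1,3) by simp
  ultimately have "strongly_clique_partitioned 3 4 {..<12} (edges L)"
    using sg by (intro strongly_clique_partitionedI) simp_all
  moreover have "card (edges L) = 42"
    using card_cliques_edges[of 2 L] cliques_2_eq_edges[OF sg] assms(1,4) by simp
  ultimately show ?thesis by (simp add: maximal_strongly_clique_partitioned_def)
qed

lemma maximal_strongly_clique_partitioned_G1:
  "maximal_strongly_clique_partitioned 3 4 {..<12} (edges G1)"
proof (rule maximal_strongly_clique_partitioned_edges)
  have "\<forall>j\<in>set [0..<12]. \<forall>i\<in>set (G1 ! j). i < j" by code_simp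
  then show "\<And>j. j < 12 \<Longrightarrow> set (G1 ! j) \<subseteq> {..<j}" by auto
qed code_simp+

lemma maximal_strongly_clique_partitioned_G2:
  "maximal_strongly_clique_partitioned 3 4 {..<12} (edges G2)"
proof (rule maximal_strongly_clique_partitioned_edges)
  have "\<forall>j\<in>set [0..<12]. \<forall>i\<in>set (G2 ! j). i < j" by code_simp
  then show "\<And>j. j < 12 \<Longrightarrow> set (G2 ! j) \<subseteq> {..<j}" by auto
qed code_simp+

lemma G1_not_iso_G2: "\<not> graph_iso {..<12} (edges G1) {..<12} (edges G2)"
proof
  assume iso: "graph_iso {..<12} (edges G1) {..<12} (edges G2)"
  have "length G1 = 12" "length G2 = 12" by code_simp+
  then have "length (pairwise_subseqs (adjacent G1) 3 [0..<12]) =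
      length (pairwise_subseqs (adjacent G2) 3 [0..<12])"
    using graph_iso_card_cliques[OF iso, of 3] card_cliques_edges[of 3 G1] card_cliques_edges[of 3 G2]
    by simp
  moreover have "length (pairwise_subseqs (adjacent G1) 3 [0..<12]) = 40" by code_simp
  moreover have "length (pairwise_subseqs (adjacent G2) 3 [0..<12]) = 42" by code_simp
  ultimately show False by simp
qed

section \<open>Labelling an arbitrary maximal graph\<close>

lemma maximal_strongly_clique_partitioned_labelling:
  assumes max: "maximal_strongly_clique_partitioned 3 4 V E"
  obtains vs ts where "distinct vs" "set vs = V" "length vs = 12"
    "ts \<in> set (filter (\<lambda>ts. \<forall>i\<in>set [0..<8]. length (filter (\<lambda>t. i \<in> set t) ts) = 2)
       (pairwise_subseqs compatible 4 neighbourhoods))"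
    "earlier_neighbours E vs (third_clique ts)"
proof -
  let ?P = "cliques 4 V E"
  note sg = maximal_strongly_clique_partitionedD(1)[OF max]
    and part = maximal_strongly_clique_partitionedD(3)[OF max]
  obtain A B C where P: "?P = {A, B, C}" and ne: "A \<noteq> B" "A \<noteq> C" "B \<noteq> C"
    using maximal_strongly_clique_partitionedD(4)[OF max] by (auto simp: card_3_iff)
  have ABC: "A \<in> ?P" "B \<in> ?P" "C \<in> ?P" using P by auto
  have disj: "A \<inter> B = {}" "A \<inter> C = {}" "B \<inter> C = {}"
    using disjointD[OF partition_onD2[OF part]] ABC ne by blast+
  have V: "V = A \<union> B \<union> C" using partition_onD1[OF part] P by auto
  have card4: "card K = 4" "finite K" if "K \<in> ?P" for K
    using that by (auto simp: cliques_def nsets_def)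
  have adj: "{x, y} \<in> E" if "K \<in> ?P" "x \<in> K" "y \<in> K" "x \<noteq> y" for K x y
    using that by (auto simp: cliques_def)
  have two: "card {y \<in> K. {y, x} \<in> E} = 2" if "K \<in> ?P" "L \<in> ?P" "K \<noteq> L" "x \<in> L" for K L x
  proof -
    have "x \<in> V - K"
      using disjointD[OF partition_onD2[OF part] that(1-3)] that(2,4) partition_onD1[OF part] by auto
    from card_neighbours_in_clique[OF max _ that(1) this] show ?thesis
      by (simp add: insert_commute)
  qed

  obtain a0 a1 a2 a3 b0 b1 b2 b3 where
    A: "A = {a0, a1, a2, a3}" and B: "B = {b0, b1, b2, b3}"
    and dA: "distinct [a0, a1, a2, a3]" and dB: "distinct [b0, b1, b2, b3]"
    and cyc: "{a \<in> A. {a, b0} \<in> E} = {a0, a1}" "{a \<in> A. {a, b1} \<in> E} = {a1, a2}"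
      "{a \<in> A. {a, b2} \<in> E} = {a2, a3}" "{a \<in> A. {a, b3} \<in> E} = {a0, a3}"
  proof (rule eight_cycle[of A B "\<lambda>a b. {a, b} \<in> E"])
    show "card {b \<in> B. {a, b} \<in> E} = 2" if "a \<in> A" for a
      using two[of B A a] that ABC ne by (simp add: insert_commute)
    show "card {a \<in> A. {a, b} \<in> E} = 2" if "b \<in> B" for b
      using two[of A B b] that ABC ne by simp
    show "inj_on (\<lambda>b. {a \<in> A. {a, b} \<in> E}) B"
      using inj_on_neighbours_in_clique[OF max _ ABC(1,2) ne(1)] by simp
  qed (use card4 ABC in auto)
  define xs where "xs = [a0, a1, a2, a3, b0, b1, b2, b3]"
  have xs: "distinct xs" "set xs = A \<union> B" "length xs = 8"
    using dA dB disj(1) A B by (auto simp: xs_def)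
  have nth_xs: "xs ! i \<in> A \<union> B" if "i < 8" for i
    using that xs nth_mem[of i xs] by simp
  have en: "earlier_neighbours E xs two_cliques"
  proof -
    have eA: "{x, y} \<in> E" if "x \<in> A" "y \<in> A" "x \<noteq> y" for x y using adj ABC(1) that by blast
    have eB: "{x, y} \<in> E" if "x \<in> B" "y \<in> B" "x \<noteq> y" for x y using adj ABC(2) that by blast
    have "{a0, a1} \<in> E" "{a0, a2} \<in> E" "{a0, a3} \<in> E" "{a1, a2} \<in> E" "{a1, a3} \<in> E" "{a2, a3} \<in> E"
      using dA A by (auto intro!: eA)
    moreover have "{b0, b1} \<in> E" "{b0, b2} \<in> E" "{b0, b3} \<in> E" "{b1, b2} \<in> E" "{b1, b3} \<in> E" "{b2, b3} \<in> E"
      using dB B by (auto intro!: eB)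
    moreover have
      "{x, b0} \<in> E \<longleftrightarrow> x = a0 \<or> x = a1" "{x, b1} \<in> E \<longleftrightarrow> x = a1 \<or> x = a2"
      "{x, b2} \<in> E \<longleftrightarrow> x = a2 \<or> x = a3" "{x, b3} \<in> E \<longleftrightarrow> x = a0 \<or> x = a3" if "x \<in> A" for x
      using cyc[unfolded set_eq_iff, THEN spec, of x] that by simp_all
    note cr = this[of a0] this[of a1] this[of a2] this[of a3]
    \<comment> \<open>All 28 pairs \<open>i < j\<close> are unfolded and settled by the listed edges
      and the cycle equivalences.\<close>
    ultimately have e: "\<forall>j<8. \<forall>i<j. i \<in> set (two_cliques ! j) \<longleftrightarrow> {xs ! i, xs ! j} \<in> E"
      using dA A by (auto simp: numeral_eq_Suc All_less_Suc two_cliques_def xs_def cr)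
    have "\<forall>j\<in>set [0..<8]. \<forall>i\<in>set (two_cliques ! j). i < j" by code_simp
    moreover have "length two_cliques = 8" by code_simp
    ultimately have "\<forall>j<length two_cliques. \<forall>i\<in>set (two_cliques ! j). i < j"
      "\<forall>j<length two_cliques. \<forall>i<j. i \<in> set (two_cliques ! j) \<longleftrightarrow> {xs ! i, xs ! j} \<in> E"
      using e by simp_all
    then show ?thesis unfolding earlier_neighbours_def by blast
  qed
  have edge_xs: "{xs ! i, xs ! j} \<in> E \<longleftrightarrow> adjacent two_cliques i j" if "i < 8" "j < 8" "i \<noteq> j" for i j
  proof -
    have "length two_cliques = 8" by code_simp
    with earlier_neighbours_edge_iff[OF en] that show ?thesis by simp
  qed
  \<comment> \<open>One contradiction for both tests of the search: \<open>D\<close> is a single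
    vertex of \<open>C\<close> with a triangle \<open>zs\<close>, or two vertices with an edge
    \<open>zs\<close>. The resulting 4-clique meets both \<open>C\<close> and
    \<open>A \<union> B\<close>, so it is none of the three.\<close>
  have no4: False if zs: "set zs \<subseteq> {..<8}" "distinct zs" "sorted_wrt (adjacent two_cliques) zs" "zs \<noteq> []"
    and D: "D \<subseteq> C" "D \<noteq> {}" and card: "length zs + card D = 4"
    and E: "\<And>c z. c \<in> D \<Longrightarrow> z \<in> set zs \<Longrightarrow> {xs ! z, c} \<in> E" for zs D
  proof -
    let ?Z = "(!) xs ` set zs"
    have Z: "?Z \<subseteq> A \<union> B" using nth_xs zs(1) by auto
    have "inj_on ((!) xs) (set zs)"
      using zs(1) xs inj_on_nth[of xs "set zs"] by auto
    then have "card ?Z = length zs" using zs(2) by (simp add: card_image distinct_card)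
    moreover have "finite D" using D(1) card4(2)[OF ABC(3)] finite_subset by blast
    moreover have "?Z \<inter> D = {}" using Z D(1) disj by blast
    ultimately have "card (?Z \<union> D) = 4" using card by (simp add: card_Un_disjoint)
    moreover have "{x, y} \<in> E" if "x \<in> ?Z \<union> D" "y \<in> ?Z \<union> D" "x \<noteq> y" for x y
    proof -
      have ZZ: "{x, y} \<in> E" if "x \<in> ?Z" "y \<in> ?Z" "x \<noteq> y" for x y
      proof -
        from that(1,2) obtain i j where
          ij: "i \<in> set zs" "j \<in> set zs" "x = xs ! i" "y = xs ! j"
          by blast
        then have "i \<noteq> j" using that(3) by auto
        then have "adjacent two_cliques i j"
          using pairwise_if_sorted_wrt[OF zs(3) symp_adjacent ij(1,2)] by simp
        with edge_xs[of i j] ij zs(1) \<open>i \<noteq> j\<close> show ?thesis by auto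
      qed
      have DD: "{x, y} \<in> E" if "x \<in> D" "y \<in> D" "x \<noteq> y" for x y
        using adj[OF ABC(3)] that D(1) by blast
      have ZD: "{x, y} \<in> E" if "x \<in> ?Z" "y \<in> D" for x y
        using E that by auto
      show ?thesis
        using that ZZ[of x y] DD[of x y] ZD[of x y] ZD[of y x] by (metis Un_iff insert_commute)
    qed
    ultimately have "?Z \<union> D \<in> ?P"
      using Z D(1) V \<open>finite D\<close> by (auto simp: cliques_def nsets_def)
    then have "?Z \<union> D = A \<or> ?Z \<union> D = B \<or> ?Z \<union> D = C" unfolding P by simp
    moreover obtain z d where z: "z \<in> ?Z" and d: "d \<in> D"
      using hd_in_set[OF zs(4)] D(2) by blast
    moreover have "z \<notin> C" "d \<notin> A \<union> B"
      using subsetD[OF Z z] subsetD[OF D(1) d] disj by blast+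
    ultimately show False by (metis UnCI)
  qed

  \<comment> \<open>Labels are kept in increasing order, so \<open>N c\<close> is literally one of
    the lists enumerated in \<open>neighbourhoods\<close>.\<close>
  define N where "N = (\<lambda>c. filter (\<lambda>i. {xs ! i, c} \<in> E) [0..<8])"
  have set_N: "set (N c) = {i. i < 8 \<and> {xs ! i, c} \<in> E}" for c by (auto simp: N_def)
  have dN: "distinct (N c)" for c by (simp add: N_def)
  have image_N: "(!) xs ` set (N c) = {y \<in> A. {y, c} \<in> E} \<union> {y \<in> B. {y, c} \<in> E}" for c
  proof -
    have "(!) xs ` set (N c) = {y \<in> set xs. {y, c} \<in> E}"
      unfolding set_N by (auto simp: in_set_conv_nth xs(3))
    then show ?thesis by (auto simp: xs(2))
  qed
  have N: "N c \<in> set neighbourhoods" if c: "c \<in> C" for c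
  proof -
    have "inj_on ((!) xs) (set (N c))"
      using xs by (intro inj_on_nth) (auto simp: set_N)
    then have "card ((!) xs ` set (N c)) = length (N c)"
      using dN by (simp add: card_image distinct_card)
    moreover have "card ((!) xs ` set (N c)) = 2 + 2"
      unfolding image_N using two[of A C c] two[of B C c] c ABC ne card4(2) disj(1)
      by (subst card_Un_disjoint) auto
    \<comment> \<open>Only the total is recorded: three labels from one of the two cliques would
      form a triangle, so the split 2 + 2 follows from the triangle test.\<close>
    ultimately have "length (N c) = 4" by simp
    moreover have "subseq (N c) [0..<8]" by (simp add: N_def)
    moreover have "pairwise_subseqs (adjacent two_cliques) 3 (N c) = []"
    proof (rule ccontr)
      assume "\<not> ?thesis"
      from hd_in_set[OF this] obtain zs
        where zs: "subseq zs (N c)" "length zs = 3" "sorted_wrt (adjacent two_cliques) zs"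
        unfolding set_pairwise_subseqs by blast
      have "set zs \<subseteq> set (N c)" using set_mono_subseq[OF zs(1)] .
      moreover have "distinct zs"
        using distinct_if_subseq[OF zs(1) dN] .
      ultimately show False
        using no4[of zs "{c}"] zs(2,3) c by (fastforce simp: set_N)
    qed
    ultimately show ?thesis
      by (simp add: neighbourhoods_def set_pairwise_subseqs[of _ 4] sorted_wrt_iff_nth_less)
  qed
  have comp: "compatible (N c) (N c')" if c: "c \<in> C" "c' \<in> C" "N c \<noteq> N c'" for c c'
  proof -
    let ?M = "filter (\<lambda>i. i \<in> set (N c')) (N c)"
    show ?thesis
      unfolding compatible_def
    proof (rule ccontr)
      assume "pairwise_subseqs (adjacent two_cliques) 2 ?M \<noteq> []"
      from hd_in_set[OF this] obtain zs
        where zs: "subseq zs ?M" "length zs = 2" "sorted_wrt (adjacent two_cliques) zs"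
        unfolding set_pairwise_subseqs by blast
      have "set zs \<subseteq> set ?M" using set_mono_subseq[OF zs(1)] .
      moreover have "distinct zs"
        using distinct_if_subseq[OF zs(1)] dN by simp
      moreover have "c \<noteq> c'" using c(3) by auto
      then have "card {c, c'} = 2" by simp
      ultimately show False
        using no4[of zs "{c, c'}"] zs(2,3) c(1,2) by (fastforce simp: set_N)
    qed
  qed
  \<comment> \<open>The part of the neighbourhood inside \<open>A\<close> already determines
    \<open>c\<close>.\<close>
  have inj_N: "inj_on N C"
  proof (rule inj_onI)
    fix c c' assume c: "c \<in> C" "c' \<in> C" and eq: "N c = N c'"
    have "{y \<in> A. {y, c} \<in> E} = (!) xs ` set (N c) \<inter> A" for c
      unfolding image_N using disj(1) by blast
    then have "{y \<in> A. {y, c} \<in> E} = {y \<in> A. {y, c'} \<in> E}" using eq by simp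
    then show "c = c'"
      using inj_on_neighbours_in_clique[OF max _ ABC(1,3) ne(2)] c by (auto dest: inj_onD)
  qed

  \<comment> \<open>The order comes from \<open>neighbourhoods\<close>, not from \<open>C\<close>,
    so \<open>ts\<close> is a subsequence by construction and only one ordering of the third clique
    has to be searched.\<close>
  define ts where "ts = filter (\<lambda>t. t \<in> N ` C) neighbourhoods"
  have set_ts: "set ts = N ` C" using N by (auto simp: ts_def)
  have dist_ts: "distinct ts"
    unfolding ts_def neighbourhoods_def by (intro distinct_filter distinct_pairwise_subseqs) simp
  have len_ts: "length ts = 4"
    using set_ts dist_ts card_image[OF inj_N] card4(1)[OF ABC(3)] distinct_card by fastforce
  have "sorted_wrt compatible ts"
    using dist_ts set_ts comp by (intro sorted_wrt_if_pairwise) auto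
  then have "ts \<in> set (pairwise_subseqs compatible 4 neighbourhoods)"
    using len_ts by (auto simp: set_pairwise_subseqs ts_def)
  moreover have "length (filter (\<lambda>t. i \<in> set t) ts) = 2" if "i < 8" for i
  proof -
    have "length (filter (\<lambda>t. i \<in> set t) ts) = card (set (filter (\<lambda>t. i \<in> set t) ts))"
      by (rule distinct_card[OF distinct_filter[OF dist_ts], symmetric])
    also have "set (filter (\<lambda>t. i \<in> set t) ts) = N ` {c \<in> C. {c, xs ! i} \<in> E}"
      using that by (auto simp: set_ts set_N insert_commute)
    also have "card \<dots> = card {c \<in> C. {c, xs ! i} \<in> E}"
      using inj_N by (intro card_image) (auto intro: inj_on_subset)
    also have "\<dots> = 2"
      using nth_xs[OF that] two[of C A] two[of C B] ABC ne by blast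
    finally show ?thesis .
  qed
  ultimately have ts: "ts \<in> set (filter (\<lambda>ts. \<forall>i\<in>set [0..<8]. length (filter (\<lambda>t. i \<in> set t) ts) = 2)
       (pairwise_subseqs compatible 4 neighbourhoods))"
    by simp

  \<comment> \<open>The vertices of \<open>C\<close> in the order of their neighbourhoods in
    \<open>ts\<close>; they receive the labels 8 to 11.\<close>
  define cs where "cs = map (inv_into C N) ts"
  have cs: "length cs = 4" "set cs = C" "distinct cs"
    using len_ts set_ts inj_N dist_ts
    by (auto simp: cs_def distinct_map inv_into_image_cancel intro: inj_on_inv_into)
  have N_cs: "N (cs ! k) = ts ! k" if "k < 4" for k
    using that len_ts set_ts nth_mem[of k ts] by (simp add: cs_def f_inv_into_f)
  have "earlier_neighbours E (xs @ cs) (third_clique ts)"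
    unfolding earlier_neighbours_def
  proof (intro allI impI)
    fix j assume "j < length (third_clique ts)"
    moreover have len2: "length two_cliques = 8" by code_simp
    ultimately have j: "j < 12" using len_ts by (simp add: third_clique_def)
    show "set (third_clique ts ! j) = {i. i < j \<and> {(xs @ cs) ! i, (xs @ cs) ! j} \<in> E}"
    proof (cases "j < 8")
      case True
      then show ?thesis
        using en len2 xs(3) by (auto simp: earlier_neighbours_def third_clique_def nth_append)
    next
      case False
      define c where "c = cs ! (j - 8)"
      have "j - 8 < 4" using j False by simp
      then have "third_clique ts ! j = ts ! (j - 8) @ [8..<j]"
        using False len2 len_ts by (simp add: third_clique_def nth_append del: upt_rec_numeral)
      then have "set (third_clique ts ! j) = {i. i < 8 \<and> {xs ! i, c} \<in> E} \<union> {8..<j}"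
        using N_cs[of "j - 8"] \<open>j - 8 < 4\<close> set_N[of c] by (simp add: c_def)
      moreover have "{cs ! (i - 8), c} \<in> E" if "8 \<le> i" "i < j" for i
      proof (rule adj[OF ABC(3)])
        show "cs ! (i - 8) \<in> C" "c \<in> C"
          using that j cs nth_mem[of "i - 8" cs] nth_mem[of "j - 8" cs] by (auto simp: c_def)
        show "cs ! (i - 8) \<noteq> c"
          using that j cs by (auto simp: c_def nth_eq_iff_index_eq)
      qed
      ultimately show ?thesis
        using False xs(3) by (auto simp: nth_append c_def)
    qed
  qed
  moreover have "distinct (xs @ cs)" "set (xs @ cs) = V" "length (xs @ cs) = 12"
    using xs cs disj V by auto
  ultimately show ?thesis using that ts by blast
qed

theorem theorem2p10:
  shows "\<exists>(V1 :: nat set) E1 (V2 :: nat set) E2.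
    maximal_strongly_clique_partitioned 3 4 V1 E1 \<and>
    maximal_strongly_clique_partitioned 3 4 V2 E2 \<and>
    \<not> graph_iso V1 E1 V2 E2 \<and>
    (\<forall>(V :: 'a set) E. maximal_strongly_clique_partitioned 3 4 V E \<longrightarrow>
       graph_iso V E V1 E1 \<or> graph_iso V E V2 E2)"
proof (intro exI conjI allI impI)
  show "\<not> graph_iso {..<12} (edges G1) {..<12} (edges G2)" by (rule G1_not_iso_G2)
  fix V :: "'a set" and E
  assume max: "maximal_strongly_clique_partitioned 3 4 V E"
  obtain vs ts where vs: "distinct vs" "set vs = V" "length vs = 12"
    and ts: "ts \<in> set (filter (\<lambda>ts. \<forall>i\<in>set [0..<8]. length (filter (\<lambda>t. i \<in> set t) ts) = 2)
       (pairwise_subseqs compatible 4 neighbourhoods))"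
    and en: "earlier_neighbours E vs (third_clique ts)"
    using maximal_strongly_clique_partitioned_labelling[OF max] .
  let ?L = "third_clique ts"
  obtain p G where p: "p \<in> set relabellings" and G: "G = G1 \<or> G = G2"
    and pG: "\<And>i j. j < 12 \<Longrightarrow> i < j \<Longrightarrow> i \<in> set (?L ! j) \<longleftrightarrow> adjacent G (p ! i) (p ! j)"
    using bspec[OF neighbourhoods_relabelling ts] by fastforce
  note perm = relabellings_permute[OF p]
  have "length two_cliques = 8" by code_simp
  moreover have "length ts = 4" using ts by (simp add: set_pairwise_subseqs)
  ultimately have len: "length ?L = 12" by (simp add: third_clique_def)
  have lenG: "length G = 12"
  proof -
    have "length G1 = 12" "length G2 = 12" by code_simp+
    then show ?thesis using G by auto
  qed
  have maxG: "maximal_strongly_clique_partitioned 3 4 {..<12} (edges G)"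
    using G maximal_strongly_clique_partitioned_G1 maximal_strongly_clique_partitioned_G2 by auto
  have "graph_iso V E {..<12} (edges ?L)"
    using graph_iso_if_earlier_neighbours[OF maximal_strongly_clique_partitionedD(1)[OF max] vs(1,2) _ en]
      len vs(3) by simp
  \<comment> \<open>Read as a list of vertices of \<open>edges G\<close>, the permutation
    \<open>p\<close> has the same earlier neighbours as \<open>vs\<close> has in \<open>E\<close>.
    Both graphs are therefore isomorphic to \<open>edges ?L\<close>.\<close>
  moreover have "earlier_neighbours (edges G) p ?L"
    unfolding earlier_neighbours_def
  proof (intro allI impI)
    fix j assume "j < length ?L"
    then have j: "j < 12" "set (?L ! j) \<subseteq> {..<j}"
      using len en by (auto simp: earlier_neighbours_def)
    have "p ! i < length G" if "i < 12" for i
      using nth_mem[of i p] perm that lenG by simp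
    with j pG[of j] show "set (?L ! j) = {i. i < j \<and> {p ! i, p ! j} \<in> edges G}"
      by (auto simp: mem_edges_iff)
  qed
  then have "graph_iso {..<12} (edges G) {..<12} (edges ?L)"
    using graph_iso_if_earlier_neighbours[OF maximal_strongly_clique_partitionedD(1)[OF maxG] perm(2,3)]
      perm(1) len by simp
  ultimately have "graph_iso V E {..<12} (edges G)"
    using graph_iso_trans graph_iso_sym by blast
  then show "graph_iso V E {..<12} (edges G1) \<or> graph_iso V E {..<12} (edges G2)"
    using G by blast
qed (rule maximal_strongly_clique_partitioned_G1 maximal_strongly_clique_partitioned_G2)+

end
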